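(* Let $(X,\tau)$ be a metrizable space, let $F=\{a_1,\dots,a_k\}\subseteq X$ be a set of $k$ distinct points with $2\le k<\infty$, let $s=(s_1,\dots,s_k)\in\mathcal G_F(\tau)$ be a compatible gauge system at $F$, and let $d\le 1$ be any metric on $X$ compatible with $\tau$ (i.e. inducing $\tau$). Define $$\rho_s(x,y)=\kappa(U_s(x),U_s(y))+\min\{H(U_s(x)),H(U_s(y))\}\,d(x,y)\qquad(x,y\in X).$$ Then $\rho_s$ is a metric on $X$, the topology $\tau_{\rho_s}$ it induces satisfies $\tau_{\rho_s}=\tau_s$, and $\tau_s\in\mathcal L_F^m(\tau)$. More precisely, for every $i$ and every $x\in X$, $$\rho_s(a_i,x)=1-u_i(x),$$ so the $\rho_s$-balls at $a_i$ are mutually cofinal with the sublevel sets $\{s_i<\varepsilon\}$, $\varepsilon>0$. The topology $\tau_{\rho_s}$ is independent of the chosen compatible metric $d\le 1$. If $d$ is complete, then $\rho_s$ is complete.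
   Context: $\mathcal L_F^m(\tau)$ is the family of all metrizable topologies $\sigma$ on $X$ with $\sigma\subseteq\tau$ and $\sigma|_{X\setminus F}=\tau|_{X\setminus F}$ (equal subspace topologies on $X\setminus F$), ordered by inclusion. A compatible gauge system at $F$ is a $k$-tuple $s=(s_1,\dots,s_k)$ of $\tau$-continuous functions $s_i:X\to[0,1]$ with $s_i^{-1}(0)=\{a_i\}$ for all $i$ and $\inf_{x\in X}\max\{s_i(x),s_j(x)\}>0$ for all $i\ne j$. $\mathcal G_F(\tau)$ is the class of all compatible gauge systems at $F$. For $s\in\mathcal G_F(\tau)$, $\tau_s$ is the topology on $X$ in which $U\subseteq X$ is open exactly when $U\in\tau$ and, for every $i$ with $a_i\in U$, there is $\varepsilon_i>0$ such that $\{x: s_i(x)<\varepsilon_i\}\subseteq U$. $\Delta^{k-1}=\{r\in[0,1]^k:\sum_i r_i=1\}$ is the standard simplex, $\kappa(r,t)=\frac12\sum_{i=1}^k|r_i-t_i|$ and $H(r)=1-\max_{1\le i\le k}r_i$ for $r,t\in\Delta^{k-1}$. For $s\in\mathcal G_F(\tau)$ put $P_i(x)=\prod_{j\ne i}s_j(x)$, $u_i(x)=P_i(x)/\sum_{\ell=1}^kP_\ell(x)$ (the denominator is always positive), and $U_s(x)=(u_1(x),\dots,u_k(x))\in\Delta^{k-1}$. Two families of sets are mutually cofinal if every member of each family contains a member of the other. *)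

theory Defs
  imports "HOL-Analysis.Analysis"
begin

text \<open>
  The space \<open>X\<close> is the \<^const>\<open>topspace\<close> of an abstract topology \<open>T\<close>. Tuples indexed by
  \<open>{1..k}\<close> are functions on \<^typ>\<open>nat\<close>; their values at other indices are never used, and neither
  are the values of functions on \<open>X\<close> at points outside \<open>X\<close>.
\<close>

definition metrizable_coarsenings :: "'a topology \<Rightarrow> 'a set \<Rightarrow> 'a topology set" where
  "metrizable_coarsenings T F =
    {S. topspace S = topspace T \<and> metrizable_space S \<and>
        (\<forall>U. openin S U \<longrightarrow> openin T U) \<and>
        subtopology S (topspace T - F) = subtopology T (topspace T - F)}"

text \<open>
  The infimum below is over a set that is bounded below by \<open>0\<close> and nonempty (it contains the
  value at \<open>a i\<close>), so it is the true infimum.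
\<close>

definition gauge_systems ::
    "'a topology \<Rightarrow> nat \<Rightarrow> (nat \<Rightarrow> 'a) \<Rightarrow> (nat \<Rightarrow> 'a \<Rightarrow> real) set" where
  "gauge_systems T k a =
    {s. (\<forall>i\<in>{1..k}. continuous_map T (top_of_set {0..1}) (s i) \<and>
                     {x \<in> topspace T. s i x = 0} = {a i}) \<and>
        (\<forall>i\<in>{1..k}. \<forall>j\<in>{1..k}. i \<noteq> j \<longrightarrow>
            0 < (INF x\<in>topspace T. max (s i x) (s j x)))}"

definition gauge_topology ::
    "'a topology \<Rightarrow> nat \<Rightarrow> (nat \<Rightarrow> 'a) \<Rightarrow> (nat \<Rightarrow> 'a \<Rightarrow> real) \<Rightarrow> 'a topology" where
  "gauge_topology T k a s =
    topology (\<lambda>U. openin T U \<and>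
      (\<forall>i\<in>{1..k}. a i \<in> U \<longrightarrow> (\<exists>\<epsilon>>0. {x \<in> topspace T. s i x < \<epsilon>} \<subseteq> U)))"

lemma openin_gauge_topology:
  "openin (gauge_topology T k a s) U \<longleftrightarrow>
    openin T U \<and> (\<forall>i\<in>{1..k}. a i \<in> U \<longrightarrow> (\<exists>\<epsilon>>0. {x \<in> topspace T. s i x < \<epsilon>} \<subseteq> U))"
proof -
  let ?N = "\<lambda>U. \<forall>i\<in>{1..k}. a i \<in> U \<longrightarrow> (\<exists>\<epsilon>>0. {x \<in> topspace T. s i x < \<epsilon>} \<subseteq> U)"
  have meet: "?N (U \<inter> V)" if N: "?N U" "?N V" for U V
  proof (intro ballI impI)
    fix i assume "i \<in> {1..k}" "a i \<in> U \<inter> V"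
    then obtain e f where "e > 0" "{x \<in> topspace T. s i x < e} \<subseteq> U"
        "f > 0" "{x \<in> topspace T. s i x < f} \<subseteq> V"
      using N(1)[rule_format, of i] N(2)[rule_format, of i] by auto
    then show "\<exists>\<epsilon>>0. {x \<in> topspace T. s i x < \<epsilon>} \<subseteq> U \<inter> V"
      by (intro exI[of _ "min e f"]) auto
  qed
  have union: "?N (\<Union>\<K>)" if N: "\<forall>K\<in>\<K>. ?N K" for \<K>
  proof (intro ballI impI)
    fix i assume "i \<in> {1..k}" "a i \<in> \<Union>\<K>"
    then obtain K e where "K \<in> \<K>" "e > 0" "{x \<in> topspace T. s i x < e} \<subseteq> K"
      using N by blast
    then show "\<exists>\<epsilon>>0. {x \<in> topspace T. s i x < \<epsilon>} \<subseteq> \<Union>\<K>"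
      by blast
  qed
  have "istopology (\<lambda>U. openin T U \<and> ?N U)"
    unfolding istopology_def
  proof (intro conjI allI impI)
    fix U V assume U: "openin T U \<and> ?N U" and V: "openin T V \<and> ?N V"
    show "openin T (U \<inter> V)"
      by (rule openin_Int[OF conjunct1[OF U] conjunct1[OF V]])
    show "?N (U \<inter> V)"
      by (rule meet[OF conjunct2[OF U] conjunct2[OF V]])
  next
    fix \<K> assume K: "\<forall>K\<in>\<K>. openin T K \<and> ?N K"
    show "openin T (\<Union>\<K>)"
      by (rule openin_Union) (rule conjunct1[OF bspec[OF K]])
    show "?N (\<Union>\<K>)"
      by (rule union) (rule ballI, rule conjunct2[OF bspec[OF K]])
  qed
  then show ?thesis
    unfolding gauge_topology_def by (simp add: topology_inverse')
qed

definition unit_simplex :: "nat \<Rightarrow> (nat \<Rightarrow> real) set" where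
  "unit_simplex k = {r \<in> {1..k} \<rightarrow>\<^sub>E {0..1}. (\<Sum>i=1..k. r i) = 1}"

definition simplex_dist :: "nat \<Rightarrow> (nat \<Rightarrow> real) \<Rightarrow> (nat \<Rightarrow> real) \<Rightarrow> real" where
  "simplex_dist k r t = (1 / 2) * (\<Sum>i=1..k. \<bar>r i - t i\<bar>)"

definition simplex_height :: "nat \<Rightarrow> (nat \<Rightarrow> real) \<Rightarrow> real" where
  "simplex_height k r = 1 - Max (r ` {1..k})"

definition gauge_prod :: "nat \<Rightarrow> (nat \<Rightarrow> 'a \<Rightarrow> real) \<Rightarrow> nat \<Rightarrow> 'a \<Rightarrow> real" where
  "gauge_prod k s i x = (\<Prod>j\<in>{1..k} - {i}. s j x)"

definition gauge_weight :: "nat \<Rightarrow> (nat \<Rightarrow> 'a \<Rightarrow> real) \<Rightarrow> nat \<Rightarrow> 'a \<Rightarrow> real" where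
  "gauge_weight k s i x = gauge_prod k s i x / (\<Sum>l=1..k. gauge_prod k s l x)"

definition gauge_map :: "nat \<Rightarrow> (nat \<Rightarrow> 'a \<Rightarrow> real) \<Rightarrow> 'a \<Rightarrow> nat \<Rightarrow> real" where
  "gauge_map k s x = (\<lambda>i\<in>{1..k}. gauge_weight k s i x)"

lemma gauge_systems_range:
  assumes "s \<in> gauge_systems T k a" "x \<in> topspace T" "i \<in> {1..k}"
  shows "0 \<le> s i x" "s i x \<le> 1"
  using assms by (auto simp: gauge_systems_def continuous_map_def Pi_iff)

lemma sum_gauge_prod_pos:
  assumes s: "s \<in> gauge_systems T k a" and x: "x \<in> topspace T" and k: "1 \<le> k"
  shows "0 < (\<Sum>l=1..k. gauge_prod k s l x)"
proof -
  have nn: "0 \<le> gauge_prod k s l x" for l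
    unfolding gauge_prod_def using gauge_systems_range[OF s x] by (intro prod_nonneg) auto
  have two: "0 < max (s i x) (s j x)" if "i \<in> {1..k}" "j \<in> {1..k}" "i \<noteq> j" for i j
  proof -
    have "bdd_below ((\<lambda>x. max (s i x) (s j x)) ` topspace T)"
      using gauge_systems_range[OF s] that by (intro bdd_belowI[of _ 0]) (auto simp: le_max_iff_disj)
    then have "(INF x\<in>topspace T. max (s i x) (s j x)) \<le> max (s i x) (s j x)"
      using x by (rule cINF_lower)
    moreover have "0 < (INF x\<in>topspace T. max (s i x) (s j x))"
      using s that unfolding gauge_systems_def by blast
    ultimately show ?thesis by linarith
  qed
  obtain i where i: "i \<in> {1..k}" "\<forall>j\<in>{1..k} - {i}. 0 < s j x"
  proof (cases "\<exists>i\<in>{1..k}. s i x = 0")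
    case True
    then obtain i where "i \<in> {1..k}" "s i x = 0" by blast
    then show thesis using two[of i] by (intro that[of i]) (auto simp: less_max_iff_disj)
  next
    case False
    then have "\<forall>j\<in>{1..k}. 0 < s j x"
      using gauge_systems_range(1)[OF s x] by (metis order_le_less)
    then show thesis using that[of 1] k by auto
  qed
  then have "0 < gauge_prod k s i x"
    unfolding gauge_prod_def by (intro prod_pos) auto
  then show ?thesis
    using nn i(1) by (intro sum_pos2[of _ i]) auto
qed

lemma gauge_map_in_unit_simplex:
  assumes "s \<in> gauge_systems T k a" "x \<in> topspace T" "1 \<le> k"
  shows "gauge_map k s x \<in> unit_simplex k"
proof -
  have nn: "0 \<le> gauge_prod k s l x" for l
    unfolding gauge_prod_def using gauge_systems_range[OF assms(1,2)]
    by (intro prod_nonneg) auto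
  have pos: "0 < (\<Sum>l=1..k. gauge_prod k s l x)"
    by (rule sum_gauge_prod_pos[OF assms])
  have "gauge_prod k s i x \<le> (\<Sum>l=1..k. gauge_prod k s l x)" if "i \<in> {1..k}" for i
    using that nn by (intro member_le_sum) auto
  moreover have "(\<Sum>i=1..k. gauge_weight k s i x) = 1"
    using pos by (simp add: gauge_weight_def flip: sum_divide_distrib)
  ultimately show ?thesis
    using nn pos by (auto simp: unit_simplex_def gauge_map_def gauge_weight_def)
qed

definition compatible_metric_le_one :: "'a topology \<Rightarrow> ('a \<Rightarrow> 'a \<Rightarrow> real) \<Rightarrow> bool" where
  "compatible_metric_le_one T d \<longleftrightarrow>
    Metric_space (topspace T) d \<and> Metric_space.mtopology (topspace T) d = T \<and>
    (\<forall>x\<in>topspace T. \<forall>y\<in>topspace T. d x y \<le> 1)"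

text \<open>
  The locale \<^locale>\<open>Metric_space\<close> demands symmetry and nonnegativity on the whole type. Since
  \<open>s\<close> is unconstrained outside the space, the distance is set to \<open>0\<close> there.
\<close>

definition gauge_metric ::
    "'a topology \<Rightarrow> nat \<Rightarrow> (nat \<Rightarrow> 'a \<Rightarrow> real) \<Rightarrow> ('a \<Rightarrow> 'a \<Rightarrow> real) \<Rightarrow> 'a \<Rightarrow> 'a \<Rightarrow> real" where
  "gauge_metric T k s d x y =
    (if x \<in> topspace T \<and> y \<in> topspace T
     then simplex_dist k (gauge_map k s x) (gauge_map k s y) +
          min (simplex_height k (gauge_map k s x)) (simplex_height k (gauge_map k s y)) * d x y
     else 0)"

definition mutually_cofinal :: "'a set set \<Rightarrow> 'a set set \<Rightarrow> bool" where
  "mutually_cofinal \<A> \<B> \<longleftrightarrow>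
    (\<forall>A\<in>\<A>. \<exists>B\<in>\<B>. B \<subseteq> A) \<and> (\<forall>B\<in>\<B>. \<exists>A\<in>\<A>. A \<subseteq> B)"

end

theory Submission
  imports Defs
begin

text \<open>
  Write \<open>u\<^sub>i\<close> for the weights, \<open>U\<close> for the map into the simplex, \<open>\<kappa>\<close> for the distance there and \<open>H\<close>
  for the height above the vertices. The metric \<open>\<rho>\<close> pulls \<open>\<kappa>\<close> back along \<open>U\<close> and adds the given
  metric \<open>d\<close> damped by the smaller of the two heights. The height vanishes exactly at the points
  \<open>a\<^sub>i\<close>, so \<open>d\<close> is switched off there, and the formula \<open>\<rho>(a\<^sub>i,x) = 1 - u\<^sub>i(x)\<close> is the distance in
  the simplex from the \<open>i\<close>-th vertex.

  The delicate point is the triangle inequality: on a path from \<open>x\<close> to \<open>z\<close> through a point \<open>y\<close> of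
  lower height the \<open>d\<close>-part of the path is cheap. By \<open>simplex_dist_detour\<close> such a detour costs at
  least as much extra \<open>\<kappa>\<close> as the height lost on it, and since \<open>d \<le> 1\<close> this pays for the
  difference.

  The topology rests on two comparisons. The defect \<open>1 - u\<^sub>i\<close> and the gauge \<open>s\<^sub>i\<close> bound
  each other up to one constant factor (\<open>weight_defect_comparable\<close>), because the gauges are
  uniformly separated: at any point at most one of them is small. Hence the balls at \<open>a\<^sub>i\<close> are
  cofinal with the sublevel sets of \<open>s\<^sub>i\<close>. At any other point the height stays bounded below on
  a small \<open>\<rho>\<close>-ball, so there \<open>\<rho>\<close> controls \<open>d\<close>, while \<open>\<rho>\<close> is controlled by \<open>d\<close> and the
  continuous weights. As the resulting topology is described without \<open>d\<close>, it does not depend on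
  the choice of \<open>d\<close>.

  For completeness, the distances from each \<open>a\<^sub>i\<close> to a \<open>\<rho>\<close>-Cauchy sequence converge. Either one of
  the limits is \<open>0\<close>, and the sequence converges to that \<open>a\<^sub>i\<close>; or all are positive, the heights
  are eventually bounded below, and the sequence is \<open>d\<close>-Cauchy.
\<close>

section \<open>Distance and height on the simplex\<close>

lemma simplex_dist_nonneg: "0 \<le> simplex_dist k r t"
  by (simp add: simplex_dist_def sum_nonneg)

lemma simplex_dist_refl: "simplex_dist k r r = 0"
  by (simp add: simplex_dist_def)

lemma simplex_dist_commute: "simplex_dist k r t = simplex_dist k t r"
  by (simp add: simplex_dist_def abs_minus_commute)

lemma simplex_dist_eq_0:
  assumes "simplex_dist k r t = 0" "i \<in> {1..k}"
  shows "r i = t i"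
  using assms by (auto simp: simplex_dist_def sum_nonneg_eq_0_iff)

lemma simplex_height_le: "i \<in> {1..k} \<Longrightarrow> simplex_height k r \<le> 1 - r i"
  by (simp add: simplex_height_def)

lemma simplex_height_attained:
  assumes "1 \<le> k"
  obtains i where "i \<in> {1..k}" "simplex_height k r = 1 - r i"
proof -
  have "Max (r ` {1..k}) \<in> r ` {1..k}"
    using assms by (intro Max_in) auto
  then show thesis
    using that unfolding simplex_height_def by (metis imageE)
qed

lemma simplex_height_cong: "(\<And>i. i \<in> {1..k} \<Longrightarrow> r i = t i) \<Longrightarrow> simplex_height k r = simplex_height k t"
  by (simp add: simplex_height_def)

text \<open>
  The quantitative triangle inequality behind the metric. Let \<open>j\<close> be a coordinate where \<open>t\<close> is
  maximal. If \<open>t\<close> lies lower than both \<open>r\<close> and \<open>v\<close>, then \<open>t\<^sub>j\<close> exceeds \<open>r\<^sub>j\<close> and \<open>v\<^sub>j\<close> by at least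
  the difference in height, and the \<open>j\<close>-th coordinate has to travel this overshoot twice. The
  other coordinates obey the ordinary triangle inequality.
\<close>

lemma simplex_dist_detour:
  assumes k: "1 \<le> k"
  shows "simplex_dist k r v + min (simplex_height k r) (simplex_height k v)
    \<le> simplex_dist k r t + simplex_dist k t v + simplex_height k t"
proof -
  obtain j where j: "j \<in> {1..k}" and top: "simplex_height k t = 1 - t j"
    by (rule simplex_height_attained[OF k])
  let ?D = "\<lambda>i. \<bar>r i - t i\<bar> + \<bar>t i - v i\<bar> - \<bar>r i - v i\<bar>"
  have "2 * (min (1 - r j) (1 - v j) - (1 - t j)) \<le> ?D j"
    by (simp add: min_def abs_if)
  also have "?D j \<le> (\<Sum>i=1..k. ?D i)"
    using j by (intro member_le_sum) auto
  also have "\<dots> = 2 * (simplex_dist k r t + simplex_dist k t v - simplex_dist k r v)"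
    by (simp add: simplex_dist_def sum.distrib sum_subtractf)
  finally show ?thesis
    using simplex_height_le[OF j, of r] simplex_height_le[OF j, of v] top
    by (simp add: min_le_iff_disj min_def split: if_splits)
qed

text \<open>
  The round trip from \<open>r\<close> to \<open>t\<close> and back, as a detour. The factor \<open>2\<close> is not optimal on the
  simplex, but any Lipschitz constant serves to keep the height bounded below on small balls.
\<close>

lemma simplex_height_diff_le:
  assumes "1 \<le> k"
  shows "simplex_height k r - simplex_height k t \<le> 2 * simplex_dist k r t"
  using simplex_dist_detour[OF assms, of r r t] simplex_dist_commute[of k r t]
  by (simp add: simplex_dist_refl)

section \<open>Gauges and their weights\<close>

locale gauge_system =
  fixes T :: "'a topology" and k :: nat and a :: "nat \<Rightarrow> 'a" and s :: "nat \<Rightarrow> 'a \<Rightarrow> real"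
  assumes two_le_k: "2 \<le> k"
    and gauges: "s \<in> gauge_systems T k a"
begin

abbreviation weight :: "nat \<Rightarrow> 'a \<Rightarrow> real" where "weight \<equiv> gauge_weight k s"
abbreviation coord :: "'a \<Rightarrow> nat \<Rightarrow> real" where "coord \<equiv> gauge_map k s"
abbreviation height :: "'a \<Rightarrow> real" where "height x \<equiv> simplex_height k (coord x)"

lemma one_le_k: "1 \<le> k"
  using two_le_k by simp

lemma gauge_continuous: "i \<in> {1..k} \<Longrightarrow> continuous_map T euclideanreal (s i)"
  using gauges by (auto simp: gauge_systems_def continuous_map_in_subtopology)

lemma gauge_zero_iff: "i \<in> {1..k} \<Longrightarrow> x \<in> topspace T \<Longrightarrow> s i x = 0 \<longleftrightarrow> x = a i"
  using gauges by (auto simp: gauge_systems_def)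

lemma apex_in_space: "i \<in> {1..k} \<Longrightarrow> a i \<in> topspace T"
  using gauges by (auto simp: gauge_systems_def)

lemmas gauge_nonneg = gauge_systems_range(1)[OF gauges]
lemmas gauge_le_1 = gauge_systems_range(2)[OF gauges]
lemmas sum_prod_pos = sum_gauge_prod_pos[OF gauges _ one_le_k]

lemma gauge_prod_nonneg: "x \<in> topspace T \<Longrightarrow> 0 \<le> gauge_prod k s i x"
  unfolding gauge_prod_def by (intro prod_nonneg) (auto simp: gauge_nonneg)

lemma gauge_prod_le_1: "x \<in> topspace T \<Longrightarrow> gauge_prod k s i x \<le> 1"
  unfolding gauge_prod_def by (intro prod_le_1) (auto simp: gauge_nonneg gauge_le_1)

lemma coord_eq [simp]: "i \<in> {1..k} \<Longrightarrow> coord x i = weight i x"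
  by (simp add: gauge_map_def)

lemma weight_nonneg: "x \<in> topspace T \<Longrightarrow> 0 \<le> weight i x"
  by (simp add: gauge_weight_def gauge_prod_nonneg sum_nonneg)

lemma sum_weight: "x \<in> topspace T \<Longrightarrow> (\<Sum>i=1..k. weight i x) = 1"
  using gauge_map_in_unit_simplex[OF gauges _ one_le_k] by (simp add: unit_simplex_def)

lemma weight_le_1:
  assumes "x \<in> topspace T" "i \<in> {1..k}"
  shows "weight i x \<le> 1"
proof -
  have "weight i x \<le> (\<Sum>i=1..k. weight i x)"
    using assms by (intro member_le_sum) (auto simp: weight_nonneg)
  then show ?thesis using sum_weight[OF assms(1)] by simp
qed

lemma sum_other_weights:
  assumes "x \<in> topspace T" "i \<in> {1..k}"
  shows "(\<Sum>l\<in>{1..k}-{i}. weight l x) = 1 - weight i x"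
  using sum_weight[OF assms(1)] sum.remove[of "{1..k}" i "\<lambda>l. weight l x"] assms(2) by simp

lemma weight_continuous: "i \<in> {1..k} \<Longrightarrow> continuous_map T euclideanreal (weight i)"
  unfolding gauge_weight_def gauge_prod_def
  by (intro continuous_map_real_divide continuous_map_sum continuous_map_prod)
     (use sum_prod_pos in \<open>auto simp: gauge_prod_def gauge_continuous less_le\<close>)

text \<open>
  The infima in the definition of a gauge system are finitely many, so they have a common positive
  lower bound \<open>\<delta>\<close>. Two gauges are then never both below \<open>\<delta>\<close> at a point; the index \<open>l\<close> is the one
  possible exception. The bound \<open>\<delta> \<le> 1\<close> lets \<open>\<delta> ^ k\<close> estimate products of any subfamily.
\<close>

lemma uniform_gap:
  obtains \<delta> where "0 < \<delta>" "\<delta> \<le> 1"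
    "\<And>x. x \<in> topspace T \<Longrightarrow> \<exists>l\<in>{1..k}. \<forall>j\<in>{1..k} - {l}. \<delta> \<le> s j x"
proof -
  let ?I = "\<lambda>(i,j). INF x\<in>topspace T. max (s i x) (s j x)"
  let ?P = "{(i,j) \<in> {1..k} \<times> {1..k}. i \<noteq> j}"
  define \<delta> where "\<delta> = Min (insert 1 (?I ` ?P))"
  have fin: "finite (insert 1 (?I ` ?P))"
    by (intro finite.insertI finite_imageI finite_subset[of ?P "{1..k} \<times> {1..k}"]) auto
  have "\<forall>e \<in> insert 1 (?I ` ?P). 0 < e"
    using gauges unfolding gauge_systems_def by auto
  then have pos: "0 < \<delta>"
    using fin unfolding \<delta>_def by (subst Min_gr_iff) auto
  have le1: "\<delta> \<le> 1"
    using fin unfolding \<delta>_def by (intro Min_le) auto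
  have gap: "\<delta> \<le> max (s i x) (s j x)"
    if "x \<in> topspace T" "i \<in> {1..k}" "j \<in> {1..k}" "i \<noteq> j" for x i j
  proof -
    have "\<delta> \<le> ?I (i,j)"
      unfolding \<delta>_def using fin that by (intro Min_le) auto
    also have "?I (i,j) \<le> max (s i x) (s j x)"
      using that gauge_nonneg unfolding prod.case
      by (intro cINF_lower bdd_belowI[of _ 0]) (auto simp: le_max_iff_disj)
    finally show ?thesis .
  qed
  have "\<exists>l\<in>{1..k}. \<forall>j\<in>{1..k} - {l}. \<delta> \<le> s j x" if x: "x \<in> topspace T" for x
  proof (cases "\<exists>l\<in>{1..k}. s l x < \<delta>")
    case True
    then obtain l where "l \<in> {1..k}" "s l x < \<delta>" by blast
    then show ?thesis using gap[OF x, of l] by (intro bexI[of _ l]) (auto simp: le_max_iff_disj)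
  next
    case False
    then show ?thesis using one_le_k by (intro bexI[of _ 1]) (auto simp: not_less)
  qed
  with pos le1 show thesis by (rule that)
qed

lemma prod_ge_power:
  assumes "0 < \<delta>" "\<delta> \<le> 1" "A \<subseteq> {1..k}" "\<And>j. j \<in> A \<Longrightarrow> \<delta> \<le> s j x"
  shows "\<delta> ^ k \<le> (\<Prod>j\<in>A. s j x)"
proof -
  have "card A \<le> k"
    using card_mono[OF _ assms(3)] by simp
  then have "\<delta> ^ k \<le> (\<Prod>j\<in>A. \<delta>)"
    using assms(1,2) by (simp add: power_decreasing)
  also have "\<dots> \<le> (\<Prod>j\<in>A. s j x)"
    using assms by (intro prod_mono) (auto intro: less_imp_le)
  finally show ?thesis .
qed

text \<open>
  The defect is the sum of the products \<open>P\<^sub>m\<close> with \<open>m \<noteq> i\<close>, divided by the sum \<open>S\<close> of all \<open>P\<^sub>m\<close>.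
  The uniform gap keeps \<open>S\<close> between \<open>\<delta> ^ k\<close> and \<open>k\<close>. Each \<open>P\<^sub>m\<close> in the numerator has the factor
  \<open>s\<^sub>i\<close>, which bounds the defect above; and for a suitable \<open>m\<close> all its other factors are at least
  \<open>\<delta>\<close>, which bounds it below.
\<close>

lemma weight_defect_comparable:
  obtains c where "0 < c"
    "\<And>i x. i \<in> {1..k} \<Longrightarrow> x \<in> topspace T \<Longrightarrow> c * s i x \<le> 1 - weight i x"
    "\<And>i x. i \<in> {1..k} \<Longrightarrow> x \<in> topspace T \<Longrightarrow> c * (1 - weight i x) \<le> s i x"
proof -
  obtain \<delta> where \<delta>: "0 < \<delta>" "\<delta> \<le> 1"
    and gap: "\<And>x. x \<in> topspace T \<Longrightarrow> \<exists>l\<in>{1..k}. \<forall>j\<in>{1..k} - {l}. \<delta> \<le> s j x"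
    by (rule uniform_gap) blast
  have k0: "0 < real k" and \<delta>k: "0 < \<delta> ^ k"
    using two_le_k \<delta> by auto
  have lower: "\<delta> ^ k / k * s i x \<le> 1 - weight i x"
    and upper: "\<delta> ^ k / k * (1 - weight i x) \<le> s i x"
    if i: "i \<in> {1..k}" and x: "x \<in> topspace T" for i x
  proof -
    let ?P = "\<lambda>l. gauge_prod k s l x"
    let ?S = "\<Sum>l=1..k. ?P l"
    obtain l where l: "l \<in> {1..k}" "\<forall>j\<in>{1..k} - {l}. \<delta> \<le> s j x"
      using gap[OF x] by blast
    have S0: "0 < ?S"
      by (rule sum_prod_pos[OF x])
    have Sk: "?S \<le> k"
      using sum_mono[of "{1..k}" ?P "\<lambda>_. 1"] gauge_prod_le_1[OF x] by simp
    have "\<delta> ^ k \<le> ?P l"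
      unfolding gauge_prod_def using \<delta> l by (intro prod_ge_power) auto
    also have "?P l \<le> ?S"
      using l(1) gauge_prod_nonneg[OF x] by (intro member_le_sum) auto
    finally have S\<delta>: "\<delta> ^ k \<le> ?S" .
    have split: "?P m = s i x * (\<Prod>j\<in>{1..k} - {m} - {i}. s j x)"
      if "m \<in> {1..k} - {i}" for m
      unfolding gauge_prod_def using that i by (intro prod.remove) auto
    have defect: "1 - weight i x = (\<Sum>m\<in>{1..k} - {i}. ?P m) / ?S"
      using sum_other_weights[OF x i] by (simp add: gauge_weight_def sum_divide_distrib)

    have "?P m \<le> s i x" if "m \<in> {1..k} - {i}" for m
      unfolding split[OF that]
      using gauge_nonneg[OF x i] gauge_nonneg[OF x] gauge_le_1[OF x]
      by (intro mult_left_le prod_le_1) auto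
    then have "(\<Sum>m\<in>{1..k} - {i}. ?P m) \<le> (\<Sum>m\<in>{1..k} - {i}. s i x)"
      by (intro sum_mono) auto
    also have "\<dots> \<le> (\<Sum>m\<in>{1..k}. s i x)"
      using gauge_nonneg[OF x i] by (intro sum_mono2) auto
    finally have "(1 - weight i x) * ?S \<le> k * s i x"
      unfolding defect using S0 by simp
    moreover have "(1 - weight i x) * \<delta> ^ k \<le> (1 - weight i x) * ?S"
      using S\<delta> weight_le_1[OF x i] by (intro mult_left_mono) auto
    ultimately show "\<delta> ^ k / k * (1 - weight i x) \<le> s i x"
      using k0 by (simp add: field_simps)

    \<comment> \<open>Omitting the index \<open>m\<close> removes the small gauge from the product. If the small gauge is
      \<open>s i\<close> itself, any other index will do, and one exists since \<open>2 \<le> k\<close>.\<close>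
    obtain m where m: "m \<in> {1..k} - {i}" "\<forall>j\<in>{1..k} - {m} - {i}. \<delta> \<le> s j x"
    proof (cases "l = i")
      case True
      have "(if i = 1 then 2 else 1) \<in> {1..k} - {i}"
        using two_le_k by auto
      then show thesis using l(2) True by (intro that) auto
    next
      case False
      then show thesis using l by (intro that[of l]) auto
    qed
    have "\<delta> ^ k * s i x \<le> ?P m"
      unfolding split[OF m(1)] mult.commute[of "\<delta> ^ k"]
      using m(2) \<delta> gauge_nonneg[OF x i] by (intro mult_left_mono prod_ge_power) auto
    also have "?P m \<le> (\<Sum>m\<in>{1..k} - {i}. ?P m)"
      using m(1) gauge_prod_nonneg[OF x] by (intro member_le_sum) auto
    also have "\<dots> = (1 - weight i x) * ?S"
      unfolding defect using S0 by simp
    also have "\<dots> \<le> (1 - weight i x) * k"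
      using Sk weight_le_1[OF x i] by (intro mult_left_mono) auto
    finally show "\<delta> ^ k / k * s i x \<le> 1 - weight i x"
      using k0 by (simp add: field_simps)
  qed
  show thesis
    by (rule that[of "\<delta> ^ k / k"]) (use lower upper \<delta>k k0 in auto)
qed

lemma weight_eq_1_iff:
  assumes "i \<in> {1..k}" "x \<in> topspace T"
  shows "weight i x = 1 \<longleftrightarrow> x = a i"
proof -
  obtain c where "0 < c" "c * s i x \<le> 1 - weight i x" "c * (1 - weight i x) \<le> s i x"
    using weight_defect_comparable assms by metis
  moreover have "0 \<le> s i x" "0 \<le> 1 - weight i x"
    using assms gauge_nonneg weight_le_1 by auto
  ultimately have "weight i x = 1 \<longleftrightarrow> s i x = 0"
    by (smt (verit) mult_pos_pos mult_zero_right)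
  then show ?thesis
    using gauge_zero_iff assms by simp
qed

lemma height_nonneg: "x \<in> topspace T \<Longrightarrow> 0 \<le> height x"
  by (rule simplex_height_attained[OF one_le_k, of "coord x"]) (simp add: weight_le_1)

lemma height_le: "i \<in> {1..k} \<Longrightarrow> height x \<le> 1 - weight i x"
  using simplex_height_le[of i k "coord x"] by simp

lemma height_eq_0_iff:
  assumes x: "x \<in> topspace T"
  shows "height x = 0 \<longleftrightarrow> x \<in> a ` {1..k}"
proof
  assume "height x = 0"
  then show "x \<in> a ` {1..k}"
    using simplex_height_attained[OF one_le_k, of "coord x"] weight_eq_1_iff[OF _ x] by force
next
  assume "x \<in> a ` {1..k}"
  then obtain i where "i \<in> {1..k}" "weight i x = 1"
    using weight_eq_1_iff[OF _ x] by blast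
  then show "height x = 0"
    using height_le[of i x] height_nonneg[OF x] by simp
qed

lemma height_diff_le: "height x - height y \<le> 2 * simplex_dist k (coord x) (coord y)"
  by (rule simplex_height_diff_le[OF one_le_k])

lemma simplex_dist_apex:
  assumes i: "i \<in> {1..k}" and x: "x \<in> topspace T"
  shows "simplex_dist k (coord (a i)) (coord x) = 1 - weight i x"
proof -
  have ai: "a i \<in> topspace T" "weight i (a i) = 1"
    using apex_in_space weight_eq_1_iff i by auto
  then have "(\<Sum>l\<in>{1..k}-{i}. weight l (a i)) = 0"
    using sum_other_weights i by simp
  then have zero: "weight l (a i) = 0" if "l \<in> {1..k} - {i}" for l
    using that weight_nonneg[OF ai(1)] by (subst (asm) sum_nonneg_eq_0_iff) auto
  have "(\<Sum>l=1..k. \<bar>coord (a i) l - coord x l\<bar>)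
      = (1 - weight i x) + (\<Sum>l\<in>{1..k}-{i}. weight l x)"
    using i ai weight_le_1[OF x i] weight_nonneg[OF x] zero
    by (subst sum.remove[of _ i]) (auto intro!: sum.cong)
  then show ?thesis
    using sum_other_weights[OF x i] by (simp add: simplex_dist_def)
qed

end

section \<open>The metric\<close>

locale gauge_system_metric = gauge_system T k a s
  for T :: "'a topology" and k a s +
  fixes d :: "'a \<Rightarrow> 'a \<Rightarrow> real"
  assumes compatible: "compatible_metric_le_one T d"
begin

abbreviation \<rho> :: "'a \<Rightarrow> 'a \<Rightarrow> real" where "\<rho> \<equiv> gauge_metric T k s d"

sublocale d: Metric_space "topspace T" d
  using compatible by (simp add: compatible_metric_le_one_def)

lemma topology_d: "d.mtopology = T"
  using compatible by (simp add: compatible_metric_le_one_def)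

lemma d_le_1: "x \<in> topspace T \<Longrightarrow> y \<in> topspace T \<Longrightarrow> d x y \<le> 1"
  using compatible by (simp add: compatible_metric_le_one_def)

lemma gauge_metric_eq:
  "x \<in> topspace T \<Longrightarrow> y \<in> topspace T \<Longrightarrow>
    \<rho> x y = simplex_dist k (coord x) (coord y) + min (height x) (height y) * d x y"
  by (simp add: gauge_metric_def)

lemma dist_term_nonneg:
  "x \<in> topspace T \<Longrightarrow> y \<in> topspace T \<Longrightarrow> 0 \<le> min (height x) (height y) * d x y"
  by (simp add: height_nonneg)

lemma simplex_dist_le_gauge_metric:
  "x \<in> topspace T \<Longrightarrow> y \<in> topspace T \<Longrightarrow> simplex_dist k (coord x) (coord y) \<le> \<rho> x y"
  using dist_term_nonneg by (simp add: gauge_metric_eq)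

lemma dist_term_le_gauge_metric:
  "x \<in> topspace T \<Longrightarrow> y \<in> topspace T \<Longrightarrow> min (height x) (height y) * d x y \<le> \<rho> x y"
  by (simp add: gauge_metric_eq simplex_dist_nonneg)

text \<open>
  With \<open>m\<close> the smaller height of the endpoints, \<open>n \<le> m\<close> is the least height on the way. Of
  \<open>m * d x z\<close>, the part \<open>n * d x z\<close> is covered by the two \<open>d\<close>-terms on the right; the rest is at
  most \<open>m - n\<close> because \<open>d \<le> 1\<close>, and this is covered by the extra cost of the detour in the simplex.
\<close>

lemma gauge_metric_triangle:
  assumes x: "x \<in> topspace T" and y: "y \<in> topspace T" and z: "z \<in> topspace T"
  shows "\<rho> x z \<le> \<rho> x y + \<rho> y z"
proof -
  let ?\<kappa> = "\<lambda>x y. simplex_dist k (coord x) (coord y)"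
  define m where "m = min (height x) (height z)"
  define n where "n = min m (height y)"
  have n: "0 \<le> n" "n \<le> m" "n \<le> min (height x) (height y)" "n \<le> min (height y) (height z)"
    using x y z by (auto simp: n_def m_def height_nonneg)
  have "?\<kappa> x z + (m - n) \<le> ?\<kappa> x y + ?\<kappa> y z"
  proof (cases "height y \<le> m")
    case True
    then show ?thesis
      using simplex_dist_detour[OF one_le_k, of "coord x" "coord z" "coord y"]
      by (simp add: n_def m_def)
  next
    case False
    have "?\<kappa> x z \<le> ?\<kappa> x y + ?\<kappa> y z"
      unfolding simplex_dist_def distrib_left[symmetric] sum.distrib[symmetric]
      by (intro mult_left_mono sum_mono) auto
    then show ?thesis using False by (simp add: n_def)
  qed
  moreover have "m * d x z \<le> (m - n) + min (height x) (height y) * d x y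
      + min (height y) (height z) * d y z"
  proof -
    have "m * d x z = (m - n) * d x z + n * d x z"
      by (simp add: algebra_simps)
    also have "\<dots> \<le> (m - n) * 1 + n * (d x y + d y z)"
      using n d_le_1[OF x z] d.triangle[OF x y z] by (intro add_mono mult_left_mono) auto
    also have "\<dots> = (m - n) + n * d x y + n * d y z"
      by (simp add: algebra_simps)
    also have "\<dots> \<le> (m - n) + min (height x) (height y) * d x y
        + min (height y) (height z) * d y z"
      using n by (intro add_mono mult_right_mono) auto
    finally show ?thesis .
  qed
  ultimately show ?thesis
    using x y z by (simp add: gauge_metric_eq m_def)
qed

lemma gauge_metric_apex:
  assumes "i \<in> {1..k}" "x \<in> topspace T"
  shows "\<rho> (a i) x = 1 - weight i x"
proof -
  have "height (a i) = 0"
    using assms apex_in_space height_eq_0_iff by blast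
  then show ?thesis
    using assms height_nonneg[of x]
    by (simp add: gauge_metric_eq apex_in_space simplex_dist_apex)
qed

lemma gauge_metric_eq_0_iff:
  assumes x: "x \<in> topspace T" and y: "y \<in> topspace T"
  shows "\<rho> x y = 0 \<longleftrightarrow> x = y"
proof
  assume "\<rho> x y = 0"
  then have \<kappa>: "simplex_dist k (coord x) (coord y) = 0"
    and hd: "min (height x) (height y) * d x y = 0"
    using simplex_dist_le_gauge_metric[OF x y] dist_term_le_gauge_metric[OF x y]
      simplex_dist_nonneg[of k "coord x" "coord y"] dist_term_nonneg[OF x y] by linarith+
  have same: "coord x i = coord y i" if "i \<in> {1..k}" for i
    using simplex_dist_eq_0[OF \<kappa> that] .
  then have heq: "height x = height y"
    by (rule simplex_height_cong)
  show "x = y"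
  proof (cases "height x = 0")
    case True
    then obtain i where i: "i \<in> {1..k}" and xi: "x = a i"
      using height_eq_0_iff[OF x] by blast
    have "weight i x = 1"
      using weight_eq_1_iff[OF i x] xi by simp
    then have "weight i y = 1"
      using same[OF i] i by simp
    then show ?thesis
      using weight_eq_1_iff[OF i y] xi by simp
  next
    case False
    then show ?thesis using hd heq x y by simp
  qed
next
  assume "x = y"
  then show "\<rho> x y = 0" using y by (simp add: gauge_metric_eq simplex_dist_refl)
qed

sublocale \<rho>: Metric_space "topspace T" \<rho>
proof
  fix x y z
  show "0 \<le> \<rho> x y"
    by (simp add: gauge_metric_def simplex_dist_nonneg height_nonneg)
  show "\<rho> x y = \<rho> y x"
    by (simp add: gauge_metric_def simplex_dist_commute[of k "coord x"] min.commute d.commute)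
  show "x \<in> topspace T \<Longrightarrow> y \<in> topspace T \<Longrightarrow> \<rho> x y = 0 \<longleftrightarrow> x = y"
    by (rule gauge_metric_eq_0_iff)
  show "x \<in> topspace T \<Longrightarrow> y \<in> topspace T \<Longrightarrow> z \<in> topspace T \<Longrightarrow> \<rho> x z \<le> \<rho> x y + \<rho> y z"
    by (rule gauge_metric_triangle)
qed

section \<open>The topology\<close>

lemma sublevel_subset_mball:
  assumes i: "i \<in> {1..k}" and r: "0 < r"
  shows "\<exists>\<epsilon>>0. {x \<in> topspace T. s i x < \<epsilon>} \<subseteq> \<rho>.mball (a i) r"
proof -
  obtain c where c: "0 < c" and upper: "\<And>x. x \<in> topspace T \<Longrightarrow> c * (1 - weight i x) \<le> s i x"
    using weight_defect_comparable i by metis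
  have "x \<in> \<rho>.mball (a i) r" if x: "x \<in> topspace T" and small: "s i x < c * r" for x
  proof -
    have "c * (1 - weight i x) < c * r"
      using upper[OF x] small by linarith
    then show ?thesis
      using c x i by (simp add: gauge_metric_apex apex_in_space)
  qed
  then show ?thesis
    using c r by (intro exI[of _ "c * r"]) auto
qed

lemma mball_subset_sublevel:
  assumes i: "i \<in> {1..k}" and \<epsilon>: "0 < \<epsilon>"
  shows "\<exists>r>0. \<rho>.mball (a i) r \<subseteq> {x \<in> topspace T. s i x < \<epsilon>}"
proof -
  obtain c where c: "0 < c" and lower: "\<And>x. x \<in> topspace T \<Longrightarrow> c * s i x \<le> 1 - weight i x"
    using weight_defect_comparable i by metis
  have "s i x < \<epsilon>" if x: "x \<in> topspace T" and near: "\<rho> (a i) x < c * \<epsilon>" for x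
  proof -
    have "c * s i x < c * \<epsilon>"
      using lower[OF x] near i x by (simp add: gauge_metric_apex)
    then show ?thesis using c by simp
  qed
  then show ?thesis
    using c \<epsilon> by (intro exI[of _ "c * \<epsilon>"]) auto
qed

lemma mball_cofinal_sublevel:
  assumes i: "i \<in> {1..k}"
  shows "mutually_cofinal {\<rho>.mball (a i) r | r. 0 < r} {{x \<in> topspace T. s i x < \<epsilon>} | \<epsilon>. 0 < \<epsilon>}"
  unfolding mutually_cofinal_def
proof (intro conjI ballI)
  fix A assume "A \<in> {\<rho>.mball (a i) r | r. 0 < r}"
  then show "\<exists>B\<in>{{x \<in> topspace T. s i x < \<epsilon>} | \<epsilon>. 0 < \<epsilon>}. B \<subseteq> A"
    using sublevel_subset_mball[OF i] by (smt (verit, best) mem_Collect_eq)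
next
  fix B assume "B \<in> {{x \<in> topspace T. s i x < \<epsilon>} | \<epsilon>. 0 < \<epsilon>}"
  then show "\<exists>A\<in>{\<rho>.mball (a i) r | r. 0 < r}. A \<subseteq> B"
    using mball_subset_sublevel[OF i] by (smt (verit, best) mem_Collect_eq)
qed

text \<open>
  Both bounds hold at every point, vertices included: \<open>\<rho> x y\<close> is at most the sum of \<open>d x y\<close> and
  the distance in the simplex, which is \<open>T\<close>-continuous in \<open>y\<close>.
\<close>

lemma mball_contains_neighbourhood:
  assumes x: "x \<in> topspace T" and r: "0 < r"
  shows "\<exists>V. openin T V \<and> x \<in> V \<and> V \<subseteq> \<rho>.mball x r"
proof -
  let ?\<kappa> = "\<lambda>y. simplex_dist k (coord x) (coord y)"
  let ?V = "{y \<in> topspace T. ?\<kappa> y \<in> {..<r/2}} \<inter> d.mball x (r/2)"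
  have "continuous_map T euclideanreal (\<lambda>y. 1 / 2 * (\<Sum>i=1..k. \<bar>weight i x - weight i y\<bar>))"
    by (intro continuous_intros) (auto simp: weight_continuous continuous_map_diff)
  then have "continuous_map T euclideanreal ?\<kappa>"
    by (simp add: simplex_dist_def)
  then have "openin T {y \<in> topspace T. ?\<kappa> y \<in> {..<r/2}}"
    by (rule openin_continuous_map_preimage) simp
  then have "openin T ?V"
    using d.openin_mball topology_d by auto
  moreover have "x \<in> ?V"
    using x r by (simp add: simplex_dist_refl)
  moreover have "?V \<subseteq> \<rho>.mball x r"
  proof
    fix y assume "y \<in> ?V"
    then have y: "y \<in> topspace T" and near: "?\<kappa> y < r/2" "d x y < r/2"
      by auto
    have "min (height x) (height y) \<le> 1"
      using height_le[of 1 x] weight_nonneg[OF x, of 1] one_le_k by auto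
    then have "min (height x) (height y) * d x y \<le> 1 * d x y"
      by (intro mult_right_mono) auto
    then show "y \<in> \<rho>.mball x r"
      using near x y by (simp add: gauge_metric_eq)
  qed
  ultimately show ?thesis by blast
qed

text \<open>
  At positive height \<open>h\<close>, a radius of at most \<open>h/4\<close> keeps the height of \<open>y\<close> at least \<open>h/2\<close>, as the
  height is \<open>2\<close>-Lipschitz. Then \<open>h/2 * d x y \<le> \<rho> x y\<close>.
\<close>

lemma small_mball_off_apices:
  assumes x: "x \<in> topspace T" and off: "x \<notin> a ` {1..k}" and r: "0 < r"
  shows "\<exists>\<eta>>0. \<rho>.mball x \<eta> \<subseteq> d.mball x r"
proof -
  define h where "h = height x"
  have h: "0 < h"
    using height_nonneg[OF x] height_eq_0_iff[OF x] off by (simp add: h_def)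
  have "\<rho>.mball x (min (h/4) (h/2 * r)) \<subseteq> d.mball x r"
  proof
    fix y assume "y \<in> \<rho>.mball x (min (h/4) (h/2 * r))"
    then have y: "y \<in> topspace T" and near: "\<rho> x y < h/4" "\<rho> x y < h/2 * r"
      by auto
    have "h/2 \<le> min (height x) (height y)"
      using height_diff_le[of x y] simplex_dist_le_gauge_metric[OF x y] near(1) h
      by (simp add: h_def)
    then have "h/2 * d x y \<le> \<rho> x y"
      using dist_term_le_gauge_metric[OF x y] mult_right_mono[of "h/2" _ "d x y"] by fastforce
    then have "h * d x y < h * r"
      using near(2) by simp
    then show "y \<in> d.mball x r" using h x y by simp
  qed
  then show ?thesis
    using h r by (intro exI[of _ "min (h/4) (h/2 * r)"]) auto
qed

theorem gauge_metric_topology: "\<rho>.mtopology = gauge_topology T k a s"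
proof (rule topology_eq[THEN iffD2], intro allI iffI)
  fix U assume U: "openin \<rho>.mtopology U"
  then have sub: "U \<subseteq> topspace T" and ball: "\<And>x. x \<in> U \<Longrightarrow> \<exists>r>0. \<rho>.mball x r \<subseteq> U"
    by (auto simp: \<rho>.openin_mtopology)
  have "openin T U"
  proof (subst openin_subopen, intro ballI)
    fix x assume "x \<in> U"
    then show "\<exists>V. openin T V \<and> x \<in> V \<and> V \<subseteq> U"
      using ball[of x] mball_contains_neighbourhood[of x] sub by (meson subset_trans subsetD)
  qed
  moreover have "\<exists>\<epsilon>>0. {x \<in> topspace T. s i x < \<epsilon>} \<subseteq> U" if i: "i \<in> {1..k}" and ai: "a i \<in> U" for i
  proof -
    from ball[OF ai] obtain r where "0 < r" "\<rho>.mball (a i) r \<subseteq> U"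
      by (elim exE conjE)
    then show ?thesis
      using sublevel_subset_mball[OF i] by (meson subset_trans)
  qed
  ultimately show "openin (gauge_topology T k a s) U"
    by (simp add: openin_gauge_topology)
next
  fix U assume U: "openin (gauge_topology T k a s) U"
  then have open_U: "openin T U"
    by (simp add: openin_gauge_topology)
  have "\<exists>r>0. \<rho>.mball x r \<subseteq> U" if xU: "x \<in> U" for x
  proof (cases "x \<in> a ` {1..k}")
    case True
    then obtain i where i: "i \<in> {1..k}" "x = a i" by blast
    then obtain \<epsilon> where "0 < \<epsilon>" "{x \<in> topspace T. s i x < \<epsilon>} \<subseteq> U"
      using U xU by (auto simp: openin_gauge_topology)
    then show ?thesis
      using mball_subset_sublevel[OF i(1)] i(2) by (meson subset_trans)
  next
    case False
    obtain r where "0 < r" "d.mball x r \<subseteq> U"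
      using open_U xU d.openin_mtopology unfolding topology_d by blast
    moreover have "x \<in> topspace T"
      using open_U xU openin_subset by blast
    ultimately show ?thesis
      using small_mball_off_apices[OF _ False] by (meson subset_trans)
  qed
  then show "openin \<rho>.mtopology U"
    using openin_subset[OF open_U] by (simp add: \<rho>.openin_mtopology)
qed

text \<open>
  The subspace topologies off the vertices agree because the finite set of vertices is closed:
  removing it from a \<open>T\<close>-open set leaves a \<open>T\<close>-open set on which the gauges impose no condition.
\<close>

theorem gauge_topology_coarsening: "gauge_topology T k a s \<in> metrizable_coarsenings T (a ` {1..k})"
proof -
  let ?S = "gauge_topology T k a s" and ?F = "a ` {1..k}"
  have top: "topspace ?S = topspace T"
    by (metis gauge_metric_topology \<rho>.topspace_mtopology)
  have metr: "metrizable_space ?S"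
    by (metis gauge_metric_topology \<rho>.metrizable_space_mtopology)
  have coarser: "openin T U" if "openin ?S U" for U
    using that by (simp add: openin_gauge_topology)
  have "t1_space T"
    by (metis topology_d d.metrizable_space_mtopology metrizable_imp_t1_space)
  then have "closedin T ?F"
    unfolding t1_space_closedin_finite using apex_in_space by (simp add: image_subset_iff)
  then have finer_off: "openin ?S (U - ?F)" if "openin T U" for U
    using that openin_diff[of T U ?F] by (simp add: openin_gauge_topology)
  have "openin (subtopology ?S (topspace T - ?F)) W \<longleftrightarrow>
      openin (subtopology T (topspace T - ?F)) W" for W
  proof
    assume "openin (subtopology T (topspace T - ?F)) W"
    then obtain U where "openin T U" "W = (U - ?F) \<inter> (topspace T - ?F)"
      unfolding openin_subtopology by blast
    then show "openin (subtopology ?S (topspace T - ?F)) W"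
      using finer_off unfolding openin_subtopology by blast
  qed (use coarser in \<open>auto simp: openin_subtopology\<close>)
  then show ?thesis
    using top metr coarser by (simp add: metrizable_coarsenings_def topology_eq)
qed

section \<open>Completeness\<close>

text \<open>
  Since \<open>height x\<close> is the least of the distances \<open>\<rho> (a i) x\<close>, a Cauchy sequence that stays away from
  all vertices has heights bounded below, and on such points \<open>d\<close> is bounded by a multiple of \<open>\<rho>\<close>.
  A \<open>d\<close>-limit is then a \<open>\<rho>\<close>-limit because the topology of \<open>\<rho>\<close> is coarser.
\<close>

theorem gauge_metric_complete:
  assumes complete: "d.mcomplete"
  shows "\<rho>.mcomplete"
  unfolding \<rho>.mcomplete_def
proof (intro allI impI)
  fix \<sigma> assume cauchy: "\<rho>.MCauchy \<sigma>"
  then have \<sigma>: "\<sigma> n \<in> topspace T" for n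
    by (auto simp: \<rho>.MCauchy_def)
  have small: "\<exists>N. \<forall>m n. N \<le> m \<longrightarrow> N \<le> n \<longrightarrow> \<rho> (\<sigma> m) (\<sigma> n) < e" if "0 < e" for e
    using cauchy that by (simp add: \<rho>.MCauchy_def)
  have "\<exists>L. (\<lambda>n. \<rho> (a i) (\<sigma> n)) \<longlonglongrightarrow> L" if i: "i \<in> {1..k}" for i
  proof -
    have "Cauchy (\<lambda>n. \<rho> (a i) (\<sigma> n))"
    proof (rule metric_CauchyI)
      fix e :: real assume "0 < e"
      then obtain N where N: "\<And>m n. N \<le> m \<Longrightarrow> N \<le> n \<Longrightarrow> \<rho> (\<sigma> m) (\<sigma> n) < e"
        using small[of e] by meson
      have "dist (\<rho> (a i) (\<sigma> m)) (\<rho> (a i) (\<sigma> n)) < e" if "N \<le> m" "N \<le> n" for m n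
        using \<rho>.mdist_reverse_triangle[OF \<sigma>[of m] apex_in_space[OF i] \<sigma>[of n]] N[OF that]
        by (simp add: dist_real_def \<rho>.commute)
      then show "\<exists>N. \<forall>m\<ge>N. \<forall>n\<ge>N. dist (\<rho> (a i) (\<sigma> m)) (\<rho> (a i) (\<sigma> n)) < e"
        by blast
    qed
    then show ?thesis
      by (simp add: Cauchy_convergent_iff convergent_def)
  qed
  then obtain L where L: "\<And>i. i \<in> {1..k} \<Longrightarrow> (\<lambda>n. \<rho> (a i) (\<sigma> n)) \<longlonglongrightarrow> L i"
    by metis
  show "\<exists>x. limitin \<rho>.mtopology \<sigma> x sequentially"
  proof (cases "\<exists>i\<in>{1..k}. L i = 0")
    case True
    then obtain i where "i \<in> {1..k}" "(\<lambda>n. \<rho> (a i) (\<sigma> n)) \<longlonglongrightarrow> 0"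
      using L by force
    then have "limitin \<rho>.mtopology \<sigma> (a i) sequentially"
      by (simp add: \<rho>.limitin_metric_dist_null apex_in_space \<sigma> \<rho>.commute)
    then show ?thesis ..
  next
    case False
    have "0 < L i" if "i \<in> {1..k}" for i
      using False that LIMSEQ_le_const[OF L[OF that], of 0] by force
    then have pos: "0 < Min (L ` {1..k})"
      using one_le_k by simp
    define c where "c = Min (L ` {1..k}) / 2"
    have c: "0 < c" "\<And>i. i \<in> {1..k} \<Longrightarrow> c < L i"
    proof -
      show "0 < c" using pos by (simp add: c_def)
      show "c < L i" if "i \<in> {1..k}" for i
      proof -
        have "Min (L ` {1..k}) \<le> L i"
          using that by (intro Min_le) auto
        then show ?thesis using pos unfolding c_def by linarith
      qed
    qed
    have "eventually (\<lambda>n. \<forall>i\<in>{1..k}. c < \<rho> (a i) (\<sigma> n)) sequentially"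
      using L c order_tendstoD(1) by (intro eventually_ball_finite) blast+
    then obtain N where N: "\<And>n i. N \<le> n \<Longrightarrow> i \<in> {1..k} \<Longrightarrow> c < \<rho> (a i) (\<sigma> n)"
      unfolding eventually_sequentially by blast
    have high: "c \<le> height (\<sigma> n)" if "N \<le> n" for n
      by (rule simplex_height_attained[OF one_le_k, of "coord (\<sigma> n)"])
         (use N[OF that] gauge_metric_apex \<sigma> in force)
    have "d.MCauchy \<sigma>"
      unfolding d.MCauchy_def
    proof (intro conjI allI impI)
      show "range \<sigma> \<subseteq> topspace T" using \<sigma> by blast
      fix e :: real assume "0 < e"
      then obtain N' where N': "\<And>m n. N' \<le> m \<Longrightarrow> N' \<le> n \<Longrightarrow> \<rho> (\<sigma> m) (\<sigma> n) < c * e"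
        using small[of "c * e"] c(1) by (meson mult_pos_pos)
      have "d (\<sigma> m) (\<sigma> n) < e" if "max N N' \<le> m" "max N N' \<le> n" for m n
      proof -
        have "c * d (\<sigma> m) (\<sigma> n) \<le> min (height (\<sigma> m)) (height (\<sigma> n)) * d (\<sigma> m) (\<sigma> n)"
          using high that by (intro mult_right_mono) auto
        also have "\<dots> \<le> \<rho> (\<sigma> m) (\<sigma> n)"
          by (rule dist_term_le_gauge_metric[OF \<sigma> \<sigma>])
        also have "\<dots> < c * e"
          using N' that by simp
        finally show ?thesis using c(1) by simp
      qed
      then show "\<exists>N. \<forall>n n'. N \<le> n \<longrightarrow> N \<le> n' \<longrightarrow> d (\<sigma> n) (\<sigma> n') < e"
        by blast
    qed
    then obtain x where "limitin T \<sigma> x sequentially"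
      using complete unfolding d.mcomplete_def topology_d by blast
    then have "limitin \<rho>.mtopology \<sigma> x sequentially"
      unfolding limitin_def gauge_metric_topology using gauge_topology_coarsening
      by (auto simp: metrizable_coarsenings_def)
    then show ?thesis ..
  qed
qed

end

theorem theorem3p4:
  fixes T :: "'a topology" and F :: "'a set" and k :: nat
    and a :: "nat \<Rightarrow> 'a" and s :: "nat \<Rightarrow> 'a \<Rightarrow> real" and d :: "'a \<Rightarrow> 'a \<Rightarrow> real"
  assumes "metrizable_space T"
    and "2 \<le> k" and "bij_betw a {1..k} F" and "F \<subseteq> topspace T"
    and "s \<in> gauge_systems T k a"
    and "compatible_metric_le_one T d"
  shows "Metric_space (topspace T) (gauge_metric T k s d) \<and>
    Metric_space.mtopology (topspace T) (gauge_metric T k s d) = gauge_topology T k a s \<and>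
    gauge_topology T k a s \<in> metrizable_coarsenings T F \<and>
    (\<forall>i\<in>{1..k}. \<forall>x\<in>topspace T. gauge_metric T k s d (a i) x = 1 - gauge_weight k s i x) \<and>
    (\<forall>i\<in>{1..k}. mutually_cofinal
        {Metric_space.mball (topspace T) (gauge_metric T k s d) (a i) r | r. 0 < r}
        {{x \<in> topspace T. s i x < \<epsilon>} | \<epsilon>. 0 < \<epsilon>}) \<and>
    (\<forall>d'. compatible_metric_le_one T d' \<longrightarrow>
        Metric_space.mtopology (topspace T) (gauge_metric T k s d') =
        Metric_space.mtopology (topspace T) (gauge_metric T k s d)) \<and>
    (Metric_space.mcomplete (topspace T) d \<longrightarrow>
        Metric_space.mcomplete (topspace T) (gauge_metric T k s d))"
proof -
  have loc: "gauge_system_metric T k a s d'" if "compatible_metric_le_one T d'" for d'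
    using assms(2,5) that
    by (simp add: gauge_system_metric_def gauge_system_def gauge_system_metric_axioms_def)
  interpret gauge_system_metric T k a s d
    by (rule loc) fact
  have F: "a ` {1..k} = F"
    using assms(3) by (simp add: bij_betw_def)
  show ?thesis
  proof (intro conjI ballI allI impI)
    show "Metric_space (topspace T) \<rho>"
      by (rule \<rho>.Metric_space_axioms)
    show "\<rho>.mtopology = gauge_topology T k a s"
      by (rule gauge_metric_topology)
    show "gauge_topology T k a s \<in> metrizable_coarsenings T F"
      using gauge_topology_coarsening by (simp only: F)
    show "\<rho> (a i) x = 1 - weight i x" if "i \<in> {1..k}" "x \<in> topspace T" for i x
      by (rule gauge_metric_apex[OF that])
    show "mutually_cofinal {\<rho>.mball (a i) r | r. 0 < r} {{x \<in> topspace T. s i x < \<epsilon>} | \<epsilon>. 0 < \<epsilon>}"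
      if "i \<in> {1..k}" for i
      by (rule mball_cofinal_sublevel[OF that])
    show "Metric_space.mtopology (topspace T) (gauge_metric T k s d') = \<rho>.mtopology"
      if "compatible_metric_le_one T d'" for d'
      using gauge_system_metric.gauge_metric_topology[OF loc[OF that]] gauge_metric_topology
      by (rule trans[OF _ sym])
    show "\<rho>.mcomplete" if "d.mcomplete"
      by (rule gauge_metric_complete[OF that])
  qed
qed

end
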